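(* Let $\mathcal{H}$ be a non-trivial complex Hilbert space, let $A\neq 0$ be a positive operator on $\mathcal{H}$, and let $T\in \mathcal{B}_{A^{1/2}}(\mathcal{H})$. Then the following assertions are equivalent: (1) $T$ is $A$-normaloid. (2) $\|T^n\|_A=\|T\|_A^n$ for all $n\in\mathbb{N}^*$. (3) $\omega_A(T)=\|T\|_A$. (4) There exists a sequence $(x_n)_n\subset\mathcal{H}$ such that $\|x_n\|_A=1$ for all $n$, $$\lim_{n\to\infty}\|Tx_n\|_A=\|T\|_A\quad\text{and}\quad \lim_{n\to\infty}|\langle Tx_n\mid x_n\rangle_A|=\omega_A(T).$$
   Context: $\mathcal{B}(\mathcal{H})$ is the algebra of bounded linear operators on $\mathcal{H}$; inner product $\langle\cdot\mid\cdot\rangle$. $A\in\mathcal{B}(\mathcal{H})$ is positive if $\langle Ax\mid x\rangle\ge 0$ for all $x\in\mathcal{H}$. Put $\langle x\mid y\rangle_A:=\langle Ax\mid y\rangle$ and $\|x\|_A:=\langle x\mid x\rangle_A^{1/2}$ (a seminorm). $\mathcal{B}_{A^{1/2}}(\mathcal{H})$ is the set of $A$-bounded operators: those $T\in\mathcal{B}(\mathcal{H})$ for which there is $\lambda>0$ with $\|Tx\|_A\le\lambda\|x\|_A$ for all $x\in\mathcal{H}$. For such $T$, $\|T\|_A:=\sup\{\|Tx\|_A/\|x\|_A : x\in\overline{\mathcal{R}(A)},\ x\neq 0\}$, where $\mathcal{R}(A)$ is the range of $A$ (closure in the norm of $\mathcal{H}$). The $A$-spectral radius of $T\in\mathcal{B}_{A^{1/2}}(\mathcal{H})$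 is $r_A(T):=\inf_{n\in\mathbb{N}^*}\|T^n\|_A^{1/n}$, with $\mathbb{N}^*$ the set of positive integers. The $A$-numerical radius is $\omega_A(T):=\sup\{|\langle Tx\mid x\rangle_A| : x\in\mathcal{H},\ \|x\|_A=1\}$. An operator $T\in\mathcal{B}_{A^{1/2}}(\mathcal{H})$ is $A$-normaloid if $r_A(T)=\|T\|_A$. *)

theory Defs
  imports "HOL-Analysis.Analysis"
begin

text \<open>
  Complex Hilbert spaces, as a type class on top of the real normed spaces of the library. The
  inner product is linear in its first argument. Positive definiteness is part of
  \<open>cinner_self\<close>, which also says that the norm (hence the topology) is the one induced by the
  inner product.
\<close>

class complex_inner_space = real_normed_vector +
  fixes scaleC :: "complex \<Rightarrow> 'a \<Rightarrow> 'a"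
    and cinner :: "'a \<Rightarrow> 'a \<Rightarrow> complex"
  assumes scaleC_add_right: "scaleC c (x + y) = scaleC c x + scaleC c y"
    and scaleC_add_left: "scaleC (c + d) x = scaleC c x + scaleC d x"
    and scaleC_scaleC: "scaleC c (scaleC d x) = scaleC (c * d) x"
    and scaleC_of_real: "scaleC (complex_of_real r) x = r *\<^sub>R x"
    and cinner_commute: "cinner x y = cnj (cinner y x)"
    and cinner_add_left: "cinner (x + y) z = cinner x z + cinner y z"
    and cinner_scaleC_left: "cinner (scaleC c x) y = c * cinner x y"
    and cinner_self: "cinner x x = complex_of_real ((norm x)\<^sup>2)"

class complex_hilbert_space = complex_inner_space + complete_space

instantiation complex :: complex_hilbert_space
begin

definition scaleC_complex :: "complex \<Rightarrow> complex \<Rightarrow> complex"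
  where "scaleC_complex c x = c * x"

definition cinner_complex :: "complex \<Rightarrow> complex \<Rightarrow> complex"
  where "cinner_complex x y = x * cnj y"

instance
proof
  fix c d x y z :: complex and r :: real
  show "scaleC c (x + y) = scaleC c x + scaleC c y"
    by (simp add: scaleC_complex_def distrib_left)
  show "scaleC (c + d) x = scaleC c x + scaleC d x"
    by (simp add: scaleC_complex_def distrib_right)
  show "scaleC c (scaleC d x) = scaleC (c * d) x"
    by (simp add: scaleC_complex_def mult.assoc)
  show "scaleC (complex_of_real r) x = r *\<^sub>R x"
    by (simp add: scaleC_complex_def scaleR_conv_of_real)
  show "cinner x y = cnj (cinner y x)"
    by (simp add: cinner_complex_def mult.commute)
  show "cinner (x + y) z = cinner x z + cinner y z"
    by (simp add: cinner_complex_def distrib_right)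
  show "cinner (scaleC c x) y = c * cinner x y"
    by (simp add: scaleC_complex_def cinner_complex_def mult.assoc)
  show "cinner x x = complex_of_real ((norm x)\<^sup>2)"
    unfolding cinner_complex_def by (rule complex_norm_square [symmetric])
qed

end

definition bounded_clinear :: "('a::complex_inner_space \<Rightarrow> 'a) \<Rightarrow> bool"
  where "bounded_clinear T \<longleftrightarrow> bounded_linear T \<and> (\<forall>c x. T (scaleC c x) = scaleC c (T x))"

definition positive_operator :: "('a::complex_inner_space \<Rightarrow> 'a) \<Rightarrow> bool"
  where "positive_operator A \<longleftrightarrow> bounded_clinear A \<and> (\<forall>x. cinner (A x) x \<in> \<real>\<^sub>\<ge>\<^sub>0)"

definition A_inner :: "('a::complex_inner_space \<Rightarrow> 'a) \<Rightarrow> 'a \<Rightarrow> 'a \<Rightarrow> complex"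
  where "A_inner A x y = cinner (A x) y"

text \<open>For positive \<open>A\<close> the number \<open>A_inner A x x\<close> is real, so taking \<open>Re\<close> only changes its type.\<close>

definition A_norm :: "('a::complex_inner_space \<Rightarrow> 'a) \<Rightarrow> 'a \<Rightarrow> real"
  where "A_norm A x = sqrt (Re (A_inner A x x))"

definition A_bounded_operators :: "('a::complex_inner_space \<Rightarrow> 'a) \<Rightarrow> ('a \<Rightarrow> 'a) set"
  where "A_bounded_operators A =
    {T. bounded_clinear T \<and> (\<exists>l>0. \<forall>x. A_norm A (T x) \<le> l * A_norm A x)}"

text \<open>
  For positive \<open>A \<noteq> 0\<close> and \<open>T \<in> A_bounded_operators A\<close> the suprema and the infimum below are
  taken over nonempty sets of reals that are bounded above and below, respectively.
\<close>

definition A_opnorm :: "('a::complex_inner_space \<Rightarrow> 'a) \<Rightarrow> ('a \<Rightarrow> 'a) \<Rightarrow> real"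
  where "A_opnorm A T = (SUP x\<in>{x \<in> closure (range A). x \<noteq> 0}. A_norm A (T x) / A_norm A x)"

definition A_spectral_radius :: "('a::complex_inner_space \<Rightarrow> 'a) \<Rightarrow> ('a \<Rightarrow> 'a) \<Rightarrow> real"
  where "A_spectral_radius A T = (INF n\<in>{1::nat..}. root n (A_opnorm A (T ^^ n)))"

definition A_numerical_radius :: "('a::complex_inner_space \<Rightarrow> 'a) \<Rightarrow> ('a \<Rightarrow> 'a) \<Rightarrow> real"
  where "A_numerical_radius A T = (SUP x\<in>{x. A_norm A x = 1}. cmod (A_inner A (T x) x))"

definition A_normaloid :: "('a::complex_inner_space \<Rightarrow> 'a) \<Rightarrow> ('a \<Rightarrow> 'a) \<Rightarrow> bool"
  where "A_normaloid A T \<longleftrightarrow>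
    T \<in> A_bounded_operators A \<and> A_spectral_radius A T = A_opnorm A T"

end

theory Submission
  imports Defs
begin

text \<open>
  Everything happens in the semi-inner product of \<open>A\<close>. The supremum in \<open>A_opnorm\<close> bounds \<open>T\<close> on all
  vectors because the range of \<open>A\<close> is dense for the seminorm.

  If \<open>\<parallel>T\<^sup>n\<parallel> = \<parallel>T\<parallel>\<^sup>n\<close> for all \<open>n\<close>, then \<open>\<parallel>S\<parallel> \<le> 2 \<omega>(S)\<close> and \<open>\<omega>(S\<^sup>2) \<le> \<omega>(S)\<^sup>2\<close> give
  \<open>\<parallel>T\<parallel>\<^sup>n \<le> 2 \<omega>(T)\<^sup>n\<close> for \<open>n = 2\<^sup>k\<close>, hence \<open>\<parallel>T\<parallel> \<le> \<omega>(T)\<close>. Conversely, unit vectors with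
  \<open>\<bar>\<langle>T x, x\<rangle>\<bar>\<close> close to \<open>\<parallel>T\<parallel>\<close> are approximate eigenvectors of \<open>T\<close>, hence of its powers. Finally,
  unit vectors that almost attain both \<open>\<parallel>T\<parallel>\<close> and \<open>\<omega>(T)\<close> yield an approximate eigenvector of the
  (formal) adjoint of \<open>T\<close> for an eigenvalue of modulus \<open>\<parallel>T\<parallel>\<close>, which forces \<open>\<omega>(T) = \<parallel>T\<parallel>\<close>.
\<close>

section \<open>Complex-linear maps, phases and squeezed limits\<close>

definition clinear :: "('a::complex_inner_space \<Rightarrow> 'a) \<Rightarrow> bool"
  where "clinear T \<longleftrightarrow> (\<forall>x y. T (x + y) = T x + T y) \<and> (\<forall>c x. T (scaleC c x) = scaleC c (T x))"

lemma clinear_add: "clinear T \<Longrightarrow> T (x + y) = T x + T y"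
  and clinear_scaleC: "clinear T \<Longrightarrow> T (scaleC c x) = scaleC c (T x)"
  by (simp_all add: clinear_def)

lemma scaleC_minus1: "scaleC (-1) x = - (x::'a::complex_inner_space)"
  using scaleC_of_real[of "-1" x] by simp

lemma clinear_diff: "clinear T \<Longrightarrow> T (x - y) = T x - T y"
  using clinear_add[of T x "- y"] clinear_scaleC[of T "-1" y] by (simp add: scaleC_minus1)

lemma clinear_scaled: "clinear T \<Longrightarrow> clinear (\<lambda>x. scaleC c (T x))"
  by (simp add: clinear_def scaleC_add_right scaleC_scaleC mult.commute)

lemma clinear_funpow: "clinear T \<Longrightarrow> clinear (T ^^ n)"
  by (induction n) (auto simp: clinear_def)

lemma bounded_clinear_imp_clinear: "bounded_clinear T \<Longrightarrow> clinear T"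
  by (simp add: bounded_clinear_def clinear_def linear_simps)

text \<open>Multiplying an operator by a unimodular \<open>c\<close> changes neither its norm nor
  its numerical radius, so a chosen value of the form may be taken real and nonnegative.\<close>

lemma obtain_phase:
  obtains c where "cmod c = 1" "c * z = complex_of_real (cmod z)"
proof (cases "z = 0")
  case True
  then show ?thesis using that[of 1] by simp
next
  case False
  show ?thesis
  proof (rule that[of "cnj z / cmod z"])
    show "cmod (cnj z / cmod z) = 1"
      using False by (simp add: norm_divide)
    show "cnj z / cmod z * z = complex_of_real (cmod z)"
      using False complex_norm_square[of z] by (simp add: field_simps power2_eq_square)
  qed
qed

lemma LIMSEQ_squeeze_zero:
  fixes a b :: "nat \<Rightarrow> real"
  assumes "b \<longlonglongrightarrow> 0" "\<And>n. 0 \<le> a n" "\<And>n. a n \<le> b n"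
  shows "a \<longlonglongrightarrow> 0"
  by (rule tendsto_sandwich[of "\<lambda>_. 0" a sequentially b]) (use assms in auto)

lemma LIMSEQ_squeeze_below:
  fixes a b :: "nat \<Rightarrow> real"
  assumes "b \<longlonglongrightarrow> L" "\<And>n. b n \<le> a n" "\<And>n. a n \<le> L"
  shows "a \<longlonglongrightarrow> L"
  by (rule tendsto_sandwich[of b a sequentially "\<lambda>_. L"]) (use assms in auto)

section \<open>Positive semidefinite sesquilinear forms and their seminorms\<close>

text \<open>Kept abstract because it is used for four forms: \<open>A_inner A\<close>,
  \<open>cinner\<close>, and the defect forms \<open>Q\<close> and \<open>P\<close> of
  \<open>numerical_gap_le\<close>.\<close>

locale psd_form =
  fixes f :: "'a::complex_inner_space \<Rightarrow> 'a \<Rightarrow> complex"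
  assumes commute: "f x y = cnj (f y x)"
    and add_left: "f (x + y) z = f x z + f y z"
    and scaleC_left: "f (scaleC c x) y = c * f x y"
    and Re_self_nonneg: "0 \<le> Re (f x x)"
begin

definition snorm :: "'a \<Rightarrow> real"
  where "snorm x = sqrt (Re (f x x))"

lemma add_right: "f x (y + z) = f x y + f x z"
  by (metis add_left commute complex_cnj_add)

lemma scaleC_right: "f x (scaleC c y) = cnj c * f x y"
  by (metis scaleC_left commute complex_cnj_mult)

lemma minus_left: "f (- x) y = - f x y"
  using scaleC_left[of "-1" x y] by (simp add: scaleC_minus1)

lemma minus_right: "f x (- y) = - f x y"
  using scaleC_right[of x "-1" y] by (simp add: scaleC_minus1)

lemma diff_left: "f (x - y) z = f x z - f y z"
  using add_left[of x "- y" z] by (simp add: minus_left)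

lemma diff_right: "f x (y - z) = f x y - f x z"
  using add_right[of x y "- z"] by (simp add: minus_right)

lemmas sesqui = add_left add_right scaleC_left scaleC_right minus_left minus_right
  diff_left diff_right

lemma snorm_nonneg: "0 \<le> snorm x"
  by (simp add: snorm_def Re_self_nonneg)

lemma snorm_sq: "(snorm x)\<^sup>2 = Re (f x x)"
  by (simp add: snorm_def Re_self_nonneg)

lemma self_eq: "f x x = complex_of_real ((snorm x)\<^sup>2)"
  using commute[of x x] by (simp add: snorm_sq complex_eq_iff)

lemma cmod_sym: "cmod (f x y) = cmod (f y x)"
  by (metis commute complex_mod_cnj)

lemma Cauchy_Schwarz: "cmod (f x y) \<le> snorm x * snorm y"
proof -
  define a b d where "a = Re (f x x)" and "b = (cmod (f x y))\<^sup>2" and "d = Re (f y y)"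
  have fyy: "f y y = complex_of_real d"
    using self_eq[of y] by (simp add: d_def snorm_sq)
  \<comment> \<open>The coefficient \<open>t * f x y\<close> absorbs the phase of
    \<open>f x y\<close>, which leaves a real quadratic polynomial in \<open>t\<close>.\<close>
  have ineq: "0 \<le> a - 2 * t * b + t\<^sup>2 * b * d" for t :: real
  proof -
    have "f (x - scaleC (t * f x y) y) (x - scaleC (t * f x y) y)
      = f x x - 2 * t * (f x y * cnj (f x y)) + t\<^sup>2 * (f x y * cnj (f x y)) * f y y"
      using commute[of y x] by (simp add: sesqui algebra_simps power2_eq_square)
    also have "\<dots> = f x x + complex_of_real (- 2 * t * b + t\<^sup>2 * b * d)"
      by (simp add: fyy b_def flip: complex_norm_square)
    finally show ?thesis
      using Re_self_nonneg[of "x - scaleC (t * f x y) y"] by (simp add: a_def)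
  qed
  have nn: "0 \<le> a" "0 \<le> b" "0 \<le> d" by (auto simp: a_def b_def d_def Re_self_nonneg)
  have "b \<le> a * d"
  proof (cases "d = 0")
    case True
    have "b = 0"
    proof (rule ccontr)
      assume "b \<noteq> 0"
      \<comment> \<open>For \<open>d = 0\<close> the polynomial is linear in \<open>t\<close>, and
        this \<open>t\<close> makes it \<open>-1\<close>.\<close>
      then show False
        using ineq[of "(a + 1) / (2 * b)"] True nn by (simp add: field_simps)
    qed
    then show ?thesis using nn by simp
  next
    case False
    then show ?thesis
      using ineq[of "1 / d"] nn by (simp add: field_simps power2_eq_square)
  qed
  then have "(cmod (f x y))\<^sup>2 \<le> (snorm x * snorm y)\<^sup>2"
    by (simp add: power_mult_distrib snorm_sq a_def b_def d_def)
  then show ?thesis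
    by (rule power2_le_imp_le) (simp add: snorm_nonneg)
qed

lemma snorm_scaleC: "snorm (scaleC c x) = cmod c * snorm x"
proof -
  have "f (scaleC c x) (scaleC c x) = (c * cnj c) * f x x"
    by (simp add: sesqui)
  also have "\<dots> = complex_of_real ((cmod c)\<^sup>2 * (snorm x)\<^sup>2)"
    unfolding self_eq complex_norm_square[symmetric] by simp
  finally have "(snorm (scaleC c x))\<^sup>2 = (cmod c * snorm x)\<^sup>2"
    by (simp add: snorm_sq power_mult_distrib)
  then show ?thesis
    by (simp add: snorm_nonneg)
qed

lemma snorm_zero [simp]: "snorm 0 = 0"
  using add_left[of 0 0 0] by (simp add: snorm_def)

lemma snorm_add_sq: "(snorm (x + y))\<^sup>2 = (snorm x)\<^sup>2 + (snorm y)\<^sup>2 + 2 * Re (f x y)"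
  using commute[of y x] by (simp add: snorm_sq sesqui)

lemma snorm_diff_sq: "(snorm (x - y))\<^sup>2 = (snorm x)\<^sup>2 + (snorm y)\<^sup>2 - 2 * Re (f x y)"
  using commute[of y x] by (simp add: snorm_sq sesqui)

lemma parallelogram: "(snorm (x + y))\<^sup>2 + (snorm (x - y))\<^sup>2 = 2 * (snorm x)\<^sup>2 + 2 * (snorm y)\<^sup>2"
  by (simp add: snorm_add_sq snorm_diff_sq)

lemma snorm_triangle: "snorm (x + y) \<le> snorm x + snorm y"
proof (rule power2_le_imp_le)
  have "Re (f x y) \<le> snorm x * snorm y"
    using Cauchy_Schwarz[of x y] complex_Re_le_cmod[of "f x y"] by linarith
  then show "(snorm (x + y))\<^sup>2 \<le> (snorm x + snorm y)\<^sup>2"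
    by (simp add: snorm_add_sq power2_sum)
qed (simp add: snorm_nonneg)

lemma snorm_minus_commute: "snorm (x - y) = snorm (y - x)"
  using snorm_scaleC[of "-1" "x - y"] by (simp add: scaleC_minus1)

lemma snorm_triangle_diff: "\<bar>snorm x - snorm y\<bar> \<le> snorm (x - y)"
  using snorm_triangle[of "x - y" y] snorm_triangle[of "y - x" x] snorm_minus_commute[of x y]
  by simp

lemma snorm_funpow_le:
  assumes "0 \<le> M" "\<And>x. snorm (T x) \<le> M * snorm x"
  shows "snorm ((T ^^ n) x) \<le> M ^ n * snorm x"
proof (induction n)
  case (Suc n)
  have "snorm ((T ^^ Suc n) x) \<le> M * snorm ((T ^^ n) x)"
    using assms(2) by simp
  also have "\<dots> \<le> M * (M ^ n * snorm x)"
    using Suc assms(1) by (rule mult_left_mono)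
  finally show ?case by (simp add: mult_ac)
qed simp

section \<open>Norm bounds, numerical bounds and powers\<close>

lemma numerical_le_norm:
  assumes "\<And>x. snorm (T x) \<le> M * snorm x"
  shows "cmod (f (T x) x) \<le> M * (snorm x)\<^sup>2"
  using Cauchy_Schwarz[of "T x" x] mult_right_mono[OF assms[of x] snorm_nonneg[of x]]
  by (simp add: power2_eq_square)

text \<open>Polarization expresses \<open>f (T x) y\<close> by four diagonal values; the
  parallelogram law adds up their bounds. Then \<open>y\<close> is taken to be a multiple of
  \<open>T x\<close>.\<close>

lemma norm_le_numerical:
  assumes T: "clinear T" and w: "\<And>x. cmod (f (T x) x) \<le> w * (snorm x)\<^sup>2"
  shows "snorm (T x) \<le> 2 * w * snorm x"
proof -
  have polar: "4 * f (T x) y = f (T (x + y)) (x + y) - f (T (x - y)) (x - y)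
      + \<i> * f (T (x + scaleC \<i> y)) (x + scaleC \<i> y) - \<i> * f (T (x - scaleC \<i> y)) (x - scaleC \<i> y)" for x y
    by (simp add: clinear_add[OF T] clinear_diff[OF T] clinear_scaleC[OF T] sesqui algebra_simps)
  have bound: "cmod (f (T x) y) \<le> w * ((snorm x)\<^sup>2 + (snorm y)\<^sup>2)" for x y
  proof -
    have "4 * cmod (f (T x) y) = cmod (4 * f (T x) y)"
      by (simp add: norm_mult)
    also have "\<dots> \<le> cmod (f (T (x + y)) (x + y)) + cmod (f (T (x - y)) (x - y))
      + cmod (f (T (x + scaleC \<i> y)) (x + scaleC \<i> y)) + cmod (f (T (x - scaleC \<i> y)) (x - scaleC \<i> y))"
      unfolding polar
      by (intro order_trans[OF norm_triangle_ineq4] order_trans[OF norm_triangle_ineq] add_mono)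
        (simp_all add: norm_mult)
    also have "\<dots> \<le> w * (snorm (x + y))\<^sup>2 + w * (snorm (x - y))\<^sup>2
      + w * (snorm (x + scaleC \<i> y))\<^sup>2 + w * (snorm (x - scaleC \<i> y))\<^sup>2"
      by (intro add_mono w)
    also have "\<dots> = w * ((snorm (x + y))\<^sup>2 + (snorm (x - y))\<^sup>2)
      + w * ((snorm (x + scaleC \<i> y))\<^sup>2 + (snorm (x - scaleC \<i> y))\<^sup>2)"
      by (simp add: algebra_simps)
    also have "\<dots> = 4 * (w * ((snorm x)\<^sup>2 + (snorm y)\<^sup>2))"
      unfolding parallelogram by (simp add: snorm_scaleC algebra_simps)
    finally show ?thesis by simp
  qed
  define a b where "a = snorm x" and "b = snorm (T x)"
  have nn: "0 \<le> a" "0 \<le> b" by (simp_all add: a_def b_def snorm_nonneg)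
  have ab: "t * b\<^sup>2 \<le> w * (a\<^sup>2 + t\<^sup>2 * b\<^sup>2)" if "0 \<le> t" for t :: real
    using bound[of x "scaleC t (T x)"] that
    by (simp add: sesqui self_eq norm_mult norm_power snorm_scaleC power_mult_distrib a_def b_def)
  show ?thesis
  proof (cases "b = 0 \<or> a = 0")
    case False
    \<comment> \<open>This \<open>t\<close> gives \<open>t * T x\<close> the same seminorm as
      \<open>x\<close>.\<close>
    then show ?thesis
      using ab[of "a / b"] nn by (simp add: field_simps power2_eq_square flip: a_def b_def)
  next
    case True
    \<comment> \<open>Null vectors go to null vectors: for \<open>a = 0\<close> and \<open>b\<close>
      nonzero, \<open>ab\<close> says \<open>t \<le> w * t^2\<close> for all
      \<open>t \<ge> 0\<close>, which fails at \<open>t = 1 / (2 * w)\<close>.\<close>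
    have "b = 0" if "a = 0"
    proof (rule ccontr)
      assume b: "b \<noteq> 0"
      have tb: "t * b\<^sup>2 \<le> w * (t\<^sup>2 * b\<^sup>2)" if "0 \<le> t" for t
        using ab[OF that] \<open>a = 0\<close> by simp
      have "w \<ge> 1" using tb[of 1] b by simp
      then show False
        using tb[of "1 / (2 * w)"] zero_less_power[of b 2] b nn by (simp add: field_simps power2_eq_square)
    qed
    then have "b = 0" using True by blast
    moreover have "0 \<le> w * a"
    proof (cases "a = 0")
      case False
      have "0 \<le> w * a\<^sup>2"
        using order_trans[OF norm_ge_zero w[of x]] by (simp add: a_def)
      then show ?thesis using False nn by (simp add: zero_le_mult_iff)
    qed simp
    ultimately show ?thesis by (simp add: mult.commute flip: a_def b_def)
  qed
qed

text \<open>The case \<open>n = 2\<close> of Pearcy's proof of Berger's power inequality, based on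
  \<open>w - T\<close> and \<open>w + T\<close> commuting and adding up to \<open>2 w\<close>.\<close>

lemma numerical_square_le:
  assumes T: "clinear T" and w: "\<And>x. cmod (f (T x) x) \<le> w * (snorm x)\<^sup>2" and "0 < w"
  shows "cmod (f (T (T x)) x) \<le> w\<^sup>2 * (snorm x)\<^sup>2"
proof -
  obtain d where d: "cmod d = 1" "d * f (T (T x)) x = cmod (f (T (T x)) x)"
    by (rule obtain_phase)
  \<comment> \<open>Rotating \<open>T\<close> by \<open>c\<close> rotates its square by
    \<open>d\<close>, so \<open>f (S (S x)) x\<close> becomes real and nonnegative.\<close>
  define c where "c = csqrt d"
  have c: "cmod c = 1" "c * c * f (T (T x)) x = cmod (f (T (T x)) x)"
    using d by (simp_all add: c_def flip: power2_eq_square)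
  define S where "S = (\<lambda>x. scaleC c (T x))"
  have S: "clinear S" unfolding S_def using T by (rule clinear_scaled)
  have wS: "Re (f (S y) y) \<le> w * (snorm y)\<^sup>2" "- Re (f (S y) y) \<le> w * (snorm y)\<^sup>2" for y
  proof -
    have "cmod (f (S y) y) \<le> w * (snorm y)\<^sup>2"
      using w[of y] by (simp add: S_def sesqui norm_mult c)
    then show "Re (f (S y) y) \<le> w * (snorm y)\<^sup>2" "- Re (f (S y) y) \<le> w * (snorm y)\<^sup>2"
      using abs_Re_le_cmod[of "f (S y) y"] by linarith+
  qed
  define u v where "u = scaleC w x + S x" and "v = scaleC w x - S x"
  \<comment> \<open>Both \<open>(w - S) u\<close> and \<open>(w + S) v\<close> equal
    \<open>(w^2 - S^2) x\<close>, and \<open>u + v = 2 w x\<close>.\<close>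
  have eq: "(w * f u u - f (S u) u) + (w * f v v + f (S v) v)
      = 2 * w * (w\<^sup>2 * f x x - f (S (S x)) x)"
    by (simp add: u_def v_def clinear_add[OF S] clinear_diff[OF S] clinear_scaleC[OF S] sesqui
        algebra_simps power2_eq_square)
  have SS: "f (S (S x)) x = cmod (f (T (T x)) x)"
    using c(2) by (simp add: S_def clinear_scaleC[OF T] scaleC_scaleC sesqui)
  have "0 \<le> Re ((w * f u u - f (S u) u) + (w * f v v + f (S v) v))"
    using wS(1)[of u] wS(2)[of v] by (simp add: self_eq)
  also have "\<dots> = 2 * w * (w\<^sup>2 * (snorm x)\<^sup>2 - cmod (f (T (T x)) x))"
    unfolding eq SS unfolding self_eq of_real_mult[symmetric] of_real_diff[symmetric]
    by (rule Re_complex_of_real)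
  finally show ?thesis
    using \<open>0 < w\<close> by (simp add: zero_le_mult_iff)
qed

lemma numerical_power_le:
  assumes T: "clinear T" and w: "\<And>x. cmod (f (T x) x) \<le> w * (snorm x)\<^sup>2" and "0 < w"
  shows "cmod (f ((T ^^ (2 ^ k)) x) x) \<le> w ^ (2 ^ k) * (snorm x)\<^sup>2"
proof (induction k arbitrary: x)
  case (Suc k)
  have "cmod (f ((T ^^ (2 ^ k)) ((T ^^ (2 ^ k)) x)) x) \<le> (w ^ 2 ^ k)\<^sup>2 * (snorm x)\<^sup>2"
    using clinear_funpow[OF T] Suc \<open>0 < w\<close> by (intro numerical_square_le) auto
  then show ?case
    by (simp add: mult_2 funpow_add power_add power2_eq_square)
qed (use w in simp)

text \<open>\<open>least\<close> expresses without a supremum that \<open>T ^^ n\<close> has norm at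
  least \<open>M ^ n\<close>. The factor 2 in \<open>M ^ 2 ^ k \<le> 2 * v ^ 2 ^ k\<close> is
  harmless: if \<open>M / v\<close> exceeded 1, its powers would be unbounded.\<close>

lemma norm_le_numerical_radius:
  assumes T: "clinear T" and w: "\<And>x. cmod (f (T x) x) \<le> w * (snorm x)\<^sup>2" and "0 \<le> w"
    and least: "\<And>n c. 0 \<le> c \<Longrightarrow> (\<And>x. snorm ((T ^^ n) x) \<le> c * snorm x) \<Longrightarrow> M ^ n \<le> c"
  shows "M \<le> w"
proof (rule field_le_epsilon)
  fix e :: real
  assume "0 < e"
  \<comment> \<open>\<open>w\<close> may be 0, while the power inequality and the division by
    \<open>v\<close> require a positive bound.\<close>
  define v where "v = w + e"
  have v: "0 < v" using \<open>0 < e\<close> \<open>0 \<le> w\<close> by (simp add: v_def)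
  have vb: "cmod (f (T x) x) \<le> v * (snorm x)\<^sup>2" for x
    using w[of x] mult_right_mono[of w v "(snorm x)\<^sup>2"] \<open>0 < e\<close> by (simp add: v_def)
  have le: "M ^ 2 ^ k \<le> 2 * v ^ 2 ^ k" for k
    using v norm_le_numerical[OF clinear_funpow[OF T] numerical_power_le[OF T vb v]]
    by (intro least) auto
  show "M \<le> w + e"
  proof (rule ccontr)
    assume "\<not> M \<le> w + e"
    then have "1 < M / v" using v by (simp add: v_def field_simps)
    then obtain n where n: "2 < (M / v) ^ n" using real_arch_pow by blast
    also have "\<dots> \<le> (M / v) ^ 2 ^ n"
      using \<open>1 < M / v\<close> by (intro power_increasing less_imp_le[OF less_exp]) auto
    finally have "2 * v ^ 2 ^ n < M ^ 2 ^ n"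
      using v by (simp add: power_divide field_simps)
    then show False using le[of n] by simp
  qed
qed

section \<open>Approximate eigenvectors of the operator and of its formal adjoint\<close>

lemma approx_eigenvector_funpow:
  assumes T: "clinear T" and "0 \<le> M" and M: "\<And>x. snorm (T x) \<le> M * snorm x"
    and l: "\<And>n. cmod (l n) \<le> M"
    and lim: "(\<lambda>n. snorm (T (x n) - scaleC (l n) (x n))) \<longlonglongrightarrow> 0"
  shows "(\<lambda>n. snorm ((T ^^ k) (x n) - scaleC (l n ^ k) (x n))) \<longlonglongrightarrow> 0"
proof (induction k)
  case 0
  have "scaleC 1 y = y" for y :: 'a using scaleC_of_real[of 1 y] by simp
  then show ?case by simp
next
  case (Suc k)
  define a b where "a n = T (x n) - scaleC (l n) (x n)"
    and "b n = (T ^^ k) (x n) - scaleC (l n ^ k) (x n)" for n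
  have "snorm ((T ^^ Suc k) (x n) - scaleC (l n ^ Suc k) (x n)) \<le> M * snorm (b n) + M ^ k * snorm (a n)" for n
  proof -
    \<comment> \<open>Telescoping: the error for \<open>Suc k\<close> is \<open>T\<close> applied to
      the error for \<open>k\<close>, plus \<open>l n ^ k\<close> times the error for 1.\<close>
    have "(T ^^ Suc k) (x n) - scaleC (l n ^ Suc k) (x n) = T (b n) + scaleC (l n ^ k) (a n)"
      using scaleC_add_right[of "l n ^ k" "T (x n) - scaleC (l n) (x n)" "scaleC (l n) (x n)"]
      by (simp add: a_def b_def clinear_diff[OF T] clinear_scaleC[OF T] scaleC_scaleC mult.commute)
    then have "snorm ((T ^^ Suc k) (x n) - scaleC (l n ^ Suc k) (x n))
        \<le> snorm (T (b n)) + cmod (l n) ^ k * snorm (a n)"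
      using snorm_triangle[of "T (b n)" "scaleC (l n ^ k) (a n)"] by (simp add: snorm_scaleC norm_power)
    also have "\<dots> \<le> M * snorm (b n) + M ^ k * snorm (a n)"
      by (intro add_mono M mult_right_mono power_mono l snorm_nonneg) simp
    finally show ?thesis .
  qed
  moreover have "(\<lambda>n. M * snorm (b n) + M ^ k * snorm (a n)) \<longlonglongrightarrow> M * 0 + M ^ k * 0"
    using lim Suc unfolding a_def b_def by (intro tendsto_intros)
  then have "(\<lambda>n. M * snorm (b n) + M ^ k * snorm (a n)) \<longlonglongrightarrow> 0"
    by simp
  ultimately show ?case
    by (rule LIMSEQ_squeeze_zero[OF _ snorm_nonneg, rotated])
qed

text \<open>With \<open>l n = f (T (x n)) (x n)\<close>, the squared distance from
  \<open>T (x n)\<close> to \<open>l n\<close> times \<open>x n\<close> is at most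
  \<open>M^2 - (cmod (l n))^2\<close>, which tends to 0. So \<open>T ^^ k\<close> stretches
  \<open>x n\<close> by nearly \<open>M ^ k\<close>.\<close>

lemma norm_power_le_of_numerical:
  assumes T: "clinear T" and "0 \<le> M" and M: "\<And>x. snorm (T x) \<le> M * snorm x"
    and unit: "\<And>n. snorm (x n) = 1"
    and lim: "(\<lambda>n. cmod (f (T (x n)) (x n))) \<longlonglongrightarrow> M"
    and c: "\<And>x. snorm ((T ^^ k) x) \<le> c * snorm x"
  shows "M ^ k \<le> c"
proof -
  define l where "l n = f (T (x n)) (x n)" for n
  have l: "cmod (l n) \<le> M" for n
    using numerical_le_norm[OF M, of "x n"] unit by (simp add: l_def)
  have sq: "(snorm (T (x n) - scaleC (l n) (x n)))\<^sup>2 \<le> M\<^sup>2 - (cmod (l n))\<^sup>2" for n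
  proof -
    have "(snorm (T (x n)))\<^sup>2 \<le> M\<^sup>2"
      using M[of "x n"] unit snorm_nonneg by (intro power_mono) auto
    moreover have "Re (f (T (x n)) (scaleC (l n) (x n))) = (cmod (l n))\<^sup>2"
      using cmod_power2[of "l n"]
      by (simp add: sesqui power2_eq_square flip: l_def)
    ultimately show ?thesis
      using unit by (simp add: snorm_diff_sq snorm_scaleC)
  qed
  have "(\<lambda>n. M\<^sup>2 - (cmod (l n))\<^sup>2) \<longlonglongrightarrow> M\<^sup>2 - M\<^sup>2"
    using lim unfolding l_def by (intro tendsto_intros)
  then have "(\<lambda>n. M\<^sup>2 - (cmod (l n))\<^sup>2) \<longlonglongrightarrow> 0"
    by simp
  then have "(\<lambda>n. (snorm (T (x n) - scaleC (l n) (x n)))\<^sup>2) \<longlonglongrightarrow> 0"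
    by (rule LIMSEQ_squeeze_zero[OF _ _ sq]) simp_all
  then have "(\<lambda>n. snorm (T (x n) - scaleC (l n) (x n))) \<longlonglongrightarrow> 0"
    by (auto dest: tendsto_real_sqrt simp: snorm_nonneg)
  then have "(\<lambda>n. snorm ((T ^^ k) (x n) - scaleC (l n ^ k) (x n))) \<longlonglongrightarrow> 0"
    by (intro approx_eigenvector_funpow[OF T \<open>0 \<le> M\<close> M l]) auto
  then have "(\<lambda>n. cmod (l n) ^ k - snorm ((T ^^ k) (x n) - scaleC (l n ^ k) (x n))) \<longlonglongrightarrow> M ^ k - 0"
    using lim unfolding l_def by (intro tendsto_intros)
  moreover have "cmod (l n) ^ k - snorm ((T ^^ k) (x n) - scaleC (l n ^ k) (x n)) \<le> c" for n
    using snorm_triangle_diff[of "(T ^^ k) (x n)" "scaleC (l n ^ k) (x n)"] c[of "x n"] unit[of n]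
    by (simp add: snorm_scaleC norm_power)
  ultimately show ?thesis
    by (auto intro: LIMSEQ_le_const2)
qed

text \<open>The defects of \<open>x\<close> in the two inequalities control the forms \<open>M\<^sup>2\<langle>x,z\<rangle> - \<langle>Tx,Tz\<rangle>\<close> and
  \<open>2w\<langle>x,z\<rangle> - \<langle>Tx,z\<rangle> - \<langle>x,Tz\<rangle>\<close> for all \<open>z\<close> at once. If both vanish, then \<open>T\<close> has a formal
  adjoint on the span of \<open>x\<close> and \<open>Tx\<close>, which maps \<open>x\<close> to \<open>2w x - Tx\<close> and \<open>Tx\<close> to \<open>M\<^sup>2 x\<close>. Its
  eigenvalues \<open>w \<plusminus> \<i> sqrt (M\<^sup>2 - w\<^sup>2)\<close> have modulus \<open>M\<close>, and \<open>v = x - c Tx\<close> is an eigenvector.\<close>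

lemma numerical_gap_le:
  assumes T: "clinear T" and "0 < M" and M: "\<And>x. snorm (T x) \<le> M * snorm x"
    and "0 \<le> w" "w \<le> M" and w: "\<And>x. cmod (f (T x) x) \<le> w * (snorm x)\<^sup>2"
    and unit: "snorm x = 1"
  shows "(M - w)\<^sup>2 \<le> M * (sqrt (w - cmod (f (T x) x)) * sqrt (8 * w) + sqrt (M\<^sup>2 - (snorm (T x))\<^sup>2))"
proof -
  obtain d where d: "cmod d = 1" "d * f (T x) x = cmod (f (T x) x)"
    by (rule obtain_phase)
  define S where "S = (\<lambda>x. scaleC d (T x))"
  have S: "clinear S" unfolding S_def using T by (rule clinear_scaled)
  have nS: "snorm (S y) = snorm (T y)" for y by (simp add: S_def snorm_scaleC d)
  have wS: "cmod (f (S y) y) \<le> w * (snorm y)\<^sup>2" for y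
    using w[of y] by (simp add: S_def sesqui norm_mult d)
  have Sx: "f (S x) x = cmod (f (T x) x)" using d by (simp add: S_def sesqui)
  \<comment> \<open>The bounds \<open>M\<close> and \<open>w\<close> make \<open>Q\<close> and
    \<open>P\<close> positive semidefinite. By Cauchy-Schwarz the diagonal values at
    \<open>x\<close>, which are the defects, then bound \<open>Q x z\<close> and
    \<open>P x z\<close>.\<close>
  define Q where "Q = (\<lambda>x z. M\<^sup>2 * f x z - f (S x) (S z))"
  define P where "P = (\<lambda>x z. 2 * w * f x z - f (S x) z - f x (S z))"
  have QQ: "Q z z = complex_of_real (M\<^sup>2 * (snorm z)\<^sup>2 - (snorm (T z))\<^sup>2)" for z
    by (simp add: Q_def self_eq nS)
  have PP: "Re (P z z) = 2 * (w * (snorm z)\<^sup>2 - Re (f (S z) z))" for z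
    using commute[of z "S z"] by (simp add: P_def self_eq)
  interpret Q: psd_form Q
  proof
    show "Q x y = cnj (Q y x)" for x y
      using commute[of x y] commute[of "S x" "S y"] by (simp add: Q_def)
    show "0 \<le> Re (Q z z)" for z
      using power_mono[OF M[of z] snorm_nonneg, of 2] by (simp add: QQ power_mult_distrib)
  qed (simp_all add: Q_def clinear_add[OF S] clinear_scaleC[OF S] sesqui algebra_simps)
  interpret P: psd_form P
  proof
    show "P x y = cnj (P y x)" for x y
      using commute[of x y] commute[of "S x" y] commute[of x "S y"] by (simp add: P_def)
    show "0 \<le> Re (P z z)" for z
      using wS[of z] complex_Re_le_cmod[of "f (S z) z"] by (simp add: PP)
  qed (simp_all add: P_def clinear_add[OF S] clinear_scaleC[OF S] sesqui algebra_simps)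
  have Qz: "Q.snorm z \<le> M * snorm z" for z
    unfolding Q.snorm_def using \<open>0 < M\<close> snorm_nonneg[of z]
    by (intro real_le_lsqrt) (auto simp: QQ power_mult_distrib)
  have Qx: "Q.snorm x = sqrt (M\<^sup>2 - (snorm (T x))\<^sup>2)"
    by (simp add: Q.snorm_def QQ unit)
  have Pz: "P.snorm z \<le> sqrt (4 * w) * snorm z" for z
    unfolding P.snorm_def using wS[of z] abs_Re_le_cmod[of "f (S z) z"] snorm_nonneg[of z] \<open>0 \<le> w\<close>
    by (intro real_le_lsqrt) (auto simp: PP power_mult_distrib)
  have Px: "P.snorm x = sqrt 2 * sqrt (w - cmod (f (T x) x))"
    using real_sqrt_mult[of 2 "w - cmod (f (T x) x)"]
    by (simp add: P.snorm_def PP unit Sx)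
  define s where "s = sqrt (M\<^sup>2 - w\<^sup>2)"
  have s: "w\<^sup>2 + s\<^sup>2 = M\<^sup>2"
    using \<open>0 \<le> w\<close> \<open>w \<le> M\<close> by (simp add: s_def power_mono)
  \<comment> \<open>\<open>mu\<close> and its conjugate are the roots of
    \<open>t^2 - 2 w t + M^2\<close>; since \<open>cmod mu = M\<close>, \<open>c\<close> is the
    inverse of \<open>mu\<close>.\<close>
  define mu where "mu = Complex w s"
  define c where "c = cnj mu / M\<^sup>2"
  have cmod_mu: "cmod mu = M"
    using s \<open>0 < M\<close> by (simp add: mu_def cmod_def)
  then have "mu \<noteq> 0"
    using \<open>0 < M\<close> by auto
  then have muc: "mu * c = 1"
    using complex_norm_square[of mu] by (simp add: c_def cmod_mu)
  have cmod_c: "cmod c = 1 / M"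
    using \<open>0 < M\<close> by (simp add: c_def norm_divide norm_mult cmod_mu power2_eq_square)
  have mu_eq: "mu = 2 * w - c * M\<^sup>2"
    using \<open>0 < M\<close> by (simp add: c_def) (simp add: mu_def complex_eq_iff)
  define v where "v = x - scaleC c (S x)"
  define E where "E = sqrt (w - cmod (f (T x) x)) * sqrt (8 * w) + sqrt (M\<^sup>2 - (snorm (T x))\<^sup>2)"
  \<comment> \<open>The failure of \<open>v\<close> to be an adjoint eigenvector for
    \<open>mu\<close>, tested against \<open>v\<close> itself, is a combination of
    \<open>Q x v\<close> and \<open>P x v\<close>.\<close>
  have "f v (S v) - mu * f v v = f x (S v) - c * f (S x) (S v) - mu * f x v + mu * c * f (S x) v"
    by (simp add: v_def sesqui algebra_simps)
  also have "\<dots> = c * Q x v - P x v"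
    unfolding muc by (simp add: mu_eq P_def Q_def algebra_simps)
  finally have "cmod (f v (S v) - mu * f v v) \<le> cmod (c * Q x v) + cmod (P x v)"
    using norm_triangle_ineq4 by metis
  also have "\<dots> \<le> 1 / M * (sqrt (M\<^sup>2 - (snorm (T x))\<^sup>2) * (M * snorm v))
      + sqrt 2 * sqrt (w - cmod (f (T x) x)) * (sqrt (4 * w) * snorm v)"
    unfolding norm_mult cmod_c
    using \<open>0 < M\<close> Q.snorm_nonneg[of x] P.snorm_nonneg[of x]
    by (intro add_mono mult_left_mono order_trans[OF Q.Cauchy_Schwarz]
        order_trans[OF P.Cauchy_Schwarz]; simp add: Qz Pz mult_left_mono flip: Qx Px)
  also have "\<dots> = E * snorm v"
    using \<open>0 < M\<close> real_sqrt_mult[of 2 "4 * w"] by (simp add: E_def algebra_simps)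
  finally have "cmod (f v (S v) - mu * f v v) \<le> E * snorm v" .
  moreover have "cmod (mu * f v v) = M * (snorm v)\<^sup>2"
    by (simp add: norm_mult norm_power cmod_mu self_eq)
  moreover have "cmod (f v (S v)) \<le> w * (snorm v)\<^sup>2"
    using wS[of v] cmod_sym[of v "S v"] by simp
  \<comment> \<open>\<open>f v (S v)\<close> is within \<open>E * snorm v\<close> of a number of
    modulus \<open>M * (snorm v)^2\<close>, yet its modulus is at most
    \<open>w * (snorm v)^2\<close>.\<close>
  ultimately have "(M - w) * (snorm v)\<^sup>2 \<le> E * snorm v"
    using norm_triangle_ineq2[of "mu * f v v" "f v (S v)"]
    by (simp add: norm_minus_commute algebra_simps)
  \<comment> \<open>Pairing \<open>v\<close> with the unit vector \<open>x\<close> keeps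
    \<open>v\<close> away from null vectors unless \<open>w = M\<close>.\<close>
  moreover have "M - w \<le> M * snorm v"
  proof -
    have "cmod (f v x) \<le> snorm v" using Cauchy_Schwarz[of v x] unit by simp
    moreover have "f v x = 1 - c * f (S x) x"
      by (simp add: v_def sesqui self_eq unit)
    moreover have "cmod (c * f (S x) x) \<le> w / M"
      using wS[of x] \<open>0 < M\<close> by (simp add: norm_mult cmod_c unit divide_right_mono)
    ultimately have "1 - w / M \<le> snorm v"
      using norm_triangle_ineq2[of 1 "c * f (S x) x"] by simp
    then show ?thesis using \<open>0 < M\<close> by (simp add: field_simps)
  qed
  moreover have "0 \<le> E"
    using Q.snorm_nonneg[of x] P.snorm_nonneg[of x] \<open>0 \<le> w\<close>
    by (simp add: E_def Qx Px zero_le_mult_iff)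
  ultimately have "(M - w) * (M - w) \<le> M * E"
  proof (cases "snorm v = 0")
    case False
    then have "(M - w) * snorm v \<le> E"
      using \<open>(M - w) * (snorm v)\<^sup>2 \<le> E * snorm v\<close> snorm_nonneg[of v]
      by (simp add: power2_eq_square flip: mult.assoc)
    then have "M * ((M - w) * snorm v) \<le> M * E" using \<open>0 < M\<close> by simp
    moreover have "(M - w) * (M - w) \<le> (M - w) * (M * snorm v)"
      using \<open>M - w \<le> M * snorm v\<close> \<open>w \<le> M\<close> by (intro mult_left_mono) auto
    ultimately show ?thesis by (simp add: mult_ac)
  qed (use \<open>w \<le> M\<close> \<open>0 < M\<close> in simp)
  then show ?thesis by (simp add: E_def power2_eq_square)
qed

lemma numerical_eq_norm_of_common_sequence:
  assumes T: "clinear T" and M: "\<And>x. snorm (T x) \<le> M * snorm x"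
    and "0 \<le> w" "w \<le> M" and w: "\<And>x. cmod (f (T x) x) \<le> w * (snorm x)\<^sup>2"
    and unit: "\<And>n. snorm (x n) = 1"
    and lim1: "(\<lambda>n. snorm (T (x n))) \<longlonglongrightarrow> M"
    and lim2: "(\<lambda>n. cmod (f (T (x n)) (x n))) \<longlonglongrightarrow> w"
  shows "w = M"
proof (cases "M = 0")
  case False
  then have "0 < M" using assms by linarith
  have "(\<lambda>n. M * (sqrt (w - cmod (f (T (x n)) (x n))) * sqrt (8 * w) + sqrt (M\<^sup>2 - (snorm (T (x n)))\<^sup>2)))
    \<longlonglongrightarrow> M * (sqrt (w - w) * sqrt (8 * w) + sqrt (M\<^sup>2 - M\<^sup>2))"
    by (intro tendsto_intros lim1 lim2)
  then have "(M - w)\<^sup>2 \<le> M * (sqrt (w - w) * sqrt (8 * w) + sqrt (M\<^sup>2 - M\<^sup>2))"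
    by (rule LIMSEQ_le_const)
      (use numerical_gap_le[OF T \<open>0 < M\<close> M \<open>0 \<le> w\<close> \<open>w \<le> M\<close> w unit] in blast)
  then show ?thesis by simp
qed (use assms in linarith)

end

section \<open>The semi-inner product of a positive operator and density of its range\<close>

lemma psd_form_cinner: "psd_form cinner"
proof
  show "0 \<le> Re (cinner x x)" for x :: 'a by (simp add: cinner_self)
qed (rule cinner_commute cinner_add_left cinner_scaleC_left)+

lemma psd_form_cinner_snorm: "psd_form.snorm cinner = norm"
  by (simp add: fun_eq_iff psd_form.snorm_def[OF psd_form_cinner] cinner_self)

lemma psd_form_A_inner:
  assumes "positive_operator A"
  shows "psd_form (A_inner A)"
proof -
  have A: "clinear A" and pos: "\<And>x. cinner (A x) x \<in> \<real>\<^sub>\<ge>\<^sub>0"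
    using assms by (auto simp: positive_operator_def bounded_clinear_imp_clinear)
  interpret C: psd_form cinner
    by (rule psd_form_cinner)
  have im: "Im (cinner (A x) x) = 0" for x
    using pos[of x] by (simp add: complex_nonneg_Reals_iff)
  show ?thesis
  proof
    fix x y
    \<comment> \<open>Real diagonal values at \<open>x + y\<close> and \<open>x + \<i> y\<close>
      give the imaginary and the real part of the symmetry.\<close>
    have "cinner (A x) y = cnj (cinner (A y) x)"
      using im[of "x + y"] im[of "x + scaleC \<i> y"] im[of x] im[of y]
      by (simp add: clinear_add[OF A] clinear_scaleC[OF A] C.sesqui complex_eq_iff)
    then show "A_inner A x y = cnj (A_inner A y x)"
      by (simp add: A_inner_def)
    show "0 \<le> Re (A_inner A x x)"
      using pos[of x] by (simp add: A_inner_def complex_nonneg_Reals_iff)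
  qed (simp_all add: A_inner_def clinear_add[OF A] clinear_scaleC[OF A] C.sesqui)
qed

lemma bounded_clinear_funpow:
  assumes "bounded_clinear T"
  shows "bounded_clinear (T ^^ n)"
proof -
  have "bounded_linear (T ^^ n)"
    using assms
    by (induction n) (auto simp: bounded_clinear_def bounded_linear_compose comp_def id_def
        intro: bounded_linear_ident)
  then show ?thesis
    using clinear_funpow[OF bounded_clinear_imp_clinear[OF assms]]
    by (simp add: bounded_clinear_def clinear_scaleC)
qed

locale positive_op =
  fixes A :: "'a::complex_inner_space \<Rightarrow> 'a"
  assumes positive: "positive_operator A"
begin

sublocale psd_form "A_inner A"
  rewrites "psd_form.snorm (A_inner A) = A_norm A"
proof -
  show *: "psd_form (A_inner A)"
    using positive by (rule psd_form_A_inner)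
  show "psd_form.snorm (A_inner A) = A_norm A"
    by (simp add: fun_eq_iff psd_form.snorm_def[OF *] A_norm_def)
qed

lemma bounded_linear_A: "bounded_linear A"
  using positive by (simp add: positive_operator_def bounded_clinear_def)

lemma range_closure: "A y \<in> closure (range A)"
  by (rule subsetD[OF closure_subset rangeI])

text \<open>This is the operator inequality \<open>A^2 \<le> K A\<close>. Cauchy-Schwarz for
  \<open>A_inner A\<close> applied to \<open>u\<close> and \<open>A u\<close> takes the place of a
  square root of \<open>A\<close>.\<close>

lemma norm_A_sq_le:
  assumes "0 \<le> K" "\<And>y. norm (A y) \<le> norm y * K"
  shows "(norm (A u))\<^sup>2 \<le> K * (A_norm A u)\<^sup>2"
proof (cases "A u = 0")
  case True
  then show ?thesis using assms(1) by simp
next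
  case False
  interpret C: psd_form cinner rewrites "psd_form.snorm cinner = norm"
    by (rule psd_form_cinner psd_form_cinner_snorm)+
  define p where "p = norm (A u)"
  have "p > 0" using False by (simp add: p_def)
  have "p\<^sup>2 \<le> A_norm A u * A_norm A (A u)"
    using Cauchy_Schwarz[of u "A u"] by (simp add: A_inner_def cinner_self p_def norm_power)
  then have "(p\<^sup>2)\<^sup>2 \<le> (A_norm A u)\<^sup>2 * (A_norm A (A u))\<^sup>2"
    by (metis power_mono power_mult_distrib zero_le_power2)
  also have "\<dots> \<le> (A_norm A u)\<^sup>2 * (K * p\<^sup>2)"
  proof (intro mult_left_mono)
    have "(A_norm A (A u))\<^sup>2 \<le> norm (A (A u)) * p"
      using C.Cauchy_Schwarz[of "A (A u)" "A u"] complex_Re_le_cmod[of "cinner (A (A u)) (A u)"]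
      by (simp add: snorm_sq A_inner_def p_def)
    also have "\<dots> \<le> (p * K) * p"
      using \<open>p > 0\<close> assms(2)[of "A u"] by (simp add: p_def mult.commute)
    finally show "(A_norm A (A u))\<^sup>2 \<le> K * p\<^sup>2"
      by (simp add: power2_eq_square mult_ac)
  qed simp
  finally have "p\<^sup>2 * p\<^sup>2 \<le> (K * (A_norm A u)\<^sup>2) * p\<^sup>2"
    by (simp only: power2_eq_square[of "p\<^sup>2"] mult_ac)
  then show ?thesis
    unfolding p_def[symmetric] by (rule mult_right_le_imp_le) (use \<open>p > 0\<close> in simp)
qed

text \<open>Landweber iteration: for \<open>B = 1 - A/K\<close>, where \<open>K\<close> is a bound of \<open>A\<close>, the norms \<open>\<parallel>B\<^sup>n x\<parallel>\<close>
  decrease, and \<open>K\<close> times the decrements of their squares dominate \<open>\<parallel>B\<^sup>n x\<parallel>\<^sub>A\<^sup>2\<close>, while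
  \<open>x - B\<^sup>n x\<close> lies in the range of \<open>A\<close>. This replaces the decomposition of the space into the
  kernel and the closed range of \<open>A\<close>.\<close>

lemma range_A_dense:
  obtains z where "\<And>n. z n \<in> range A" "(\<lambda>n. A_norm A (x - z n)) \<longlonglongrightarrow> 0"
proof -
  interpret C: psd_form cinner rewrites "psd_form.snorm cinner = norm"
    by (rule psd_form_cinner psd_form_cinner_snorm)+
  obtain K where K: "K > 0" "\<And>y. norm (A y) \<le> norm y * K"
    using bounded_linear.pos_bounded[OF bounded_linear_A] by blast
  define B where "B = (\<lambda>y. y - (1 / K) *\<^sub>R A y)"
  define s where "s n = (norm ((B ^^ n) x))\<^sup>2" for n
  \<comment> \<open>Expanding the square of \<open>norm (B u)\<close> gives a decrease of
    \<open>2 / K\<close> times \<open>(A_norm A u)^2\<close>; by \<open>norm_A_sq_le\<close> the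
    quadratic term gives back at most half of it.\<close>
  have step: "(A_norm A u)\<^sup>2 \<le> K * ((norm u)\<^sup>2 - (norm (B u))\<^sup>2)" for u
  proof -
    have "Re (cinner u ((1 / K) *\<^sub>R A u)) = (1 / K) * (A_norm A u)\<^sup>2"
      using C.commute[of u "A u"] unfolding scaleC_of_real[symmetric]
      by (simp add: C.sesqui snorm_sq A_inner_def)
    then have "(norm (B u))\<^sup>2 = (norm u)\<^sup>2 + (1 / K)\<^sup>2 * (norm (A u))\<^sup>2 - 2 * (1 / K) * (A_norm A u)\<^sup>2"
      using C.snorm_diff_sq[of u "(1 / K) *\<^sub>R A u"] K(1)
      by (simp add: B_def power_mult_distrib power_divide)
    moreover have "(1 / K)\<^sup>2 * (norm (A u))\<^sup>2 \<le> (1 / K)\<^sup>2 * (K * (A_norm A u)\<^sup>2)"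
      using norm_A_sq_le[OF less_imp_le[OF K(1)] K(2)] by (intro mult_left_mono) auto
    moreover have "(1 / K)\<^sup>2 * (K * (A_norm A u)\<^sup>2) = (1 / K) * (A_norm A u)\<^sup>2"
      using K(1) by (simp add: field_simps power2_eq_square)
    ultimately have "(1 / K) * (A_norm A u)\<^sup>2 \<le> (norm u)\<^sup>2 - (norm (B u))\<^sup>2"
      by linarith
    then show ?thesis
      using K(1) by (simp add: field_simps)
  qed
  have A_le: "(A_norm A ((B ^^ n) x))\<^sup>2 \<le> K * (s n - s (Suc n))" for n
    using step by (simp add: s_def)
  have "0 \<le> s n - s (Suc n)" for n
    using order_trans[OF zero_le_power2 A_le[of n]] K(1) by (simp add: zero_le_mult_iff)
  then have "decseq s"
    by (simp add: decseq_Suc_iff)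
  then obtain L where L: "s \<longlonglongrightarrow> L"
    using decseq_convergent[of s 0] by (auto simp: s_def)
  have "(\<lambda>n. K * (s n - s (Suc n))) \<longlonglongrightarrow> K * (L - L)"
    by (intro tendsto_intros L LIMSEQ_Suc)
  then have "(\<lambda>n. K * (s n - s (Suc n))) \<longlonglongrightarrow> 0"
    by simp
  then have "(\<lambda>n. (A_norm A ((B ^^ n) x))\<^sup>2) \<longlonglongrightarrow> 0"
    by (rule LIMSEQ_squeeze_zero[OF _ _ A_le]) simp
  then have lim: "(\<lambda>n. A_norm A ((B ^^ n) x)) \<longlonglongrightarrow> 0"
    by (auto dest: tendsto_real_sqrt simp: snorm_nonneg)
  show thesis
  proof (rule that)
    show "x - (B ^^ n) x \<in> range A" for n
    proof (induction n)
      case 0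
      show ?case
        using linear_simps(3)[OF bounded_linear_A] by (auto intro: range_eqI[of _ _ 0])
    next
      case (Suc n)
      then obtain a where "x - (B ^^ n) x = A a" by blast
      then have "x - (B ^^ Suc n) x = A (a + (1 / K) *\<^sub>R (B ^^ n) x)"
        by (simp add: B_def linear_simps[OF bounded_linear_A] algebra_simps)
      then show ?case by blast
    qed
    show "(\<lambda>n. A_norm A (x - (x - (B ^^ n) x))) \<longlonglongrightarrow> 0"
      using lim by simp
  qed
qed

section \<open>The operator seminorm\<close>

lemma A_bounded_funpow:
  assumes "T \<in> A_bounded_operators A"
  shows "T ^^ n \<in> A_bounded_operators A"
proof -
  obtain l where "l > 0" "\<And>x. A_norm A (T x) \<le> l * A_norm A x"
    using assms by (auto simp: A_bounded_operators_def)
  then have "l ^ n > 0" "\<And>x. A_norm A ((T ^^ n) x) \<le> l ^ n * A_norm A x"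
    by (auto intro: snorm_funpow_le)
  then show ?thesis
    using assms bounded_clinear_funpow by (auto simp: A_bounded_operators_def)
qed

lemma opnorm_upper:
  assumes T: "T \<in> A_bounded_operators A" and x: "x \<in> closure (range A)" "x \<noteq> 0"
  shows "A_norm A (T x) / A_norm A x \<le> A_opnorm A T"
proof -
  obtain l where l: "l > 0" "\<And>x. A_norm A (T x) \<le> l * A_norm A x"
    using T by (auto simp: A_bounded_operators_def)
  \<comment> \<open>A vanishing denominator is harmless, since division by 0 yields 0.\<close>
  have "A_norm A (T y) / A_norm A y \<le> l" for y
    using l(1) l(2)[of y] snorm_nonneg[of y] by (cases "A_norm A y = 0") (auto simp: field_simps)
  then have "bdd_above ((\<lambda>x. A_norm A (T x) / A_norm A x) ` {x \<in> closure (range A). x \<noteq> 0})"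
    by (intro bdd_aboveI[of _ l]) auto
  then show ?thesis
    unfolding A_opnorm_def using x by (intro cSUP_upper) auto
qed

text \<open>Approximating \<open>x\<close> in the seminorm by \<open>z n\<close> in the range of
  \<open>A\<close> extends the bound from the index set of the supremum to all vectors;
  \<open>T (z n)\<close> approximates \<open>T x\<close> because \<open>T\<close> is
  \<open>A\<close>-bounded.\<close>

lemma opnorm_bound:
  assumes T: "T \<in> A_bounded_operators A"
  shows "A_norm A (T x) \<le> A_opnorm A T * A_norm A x"
proof -
  obtain l where l: "l > 0" "\<And>x. A_norm A (T x) \<le> l * A_norm A x"
    using T by (auto simp: A_bounded_operators_def)
  have lin: "clinear T"
    using T by (auto simp: A_bounded_operators_def bounded_clinear_imp_clinear)
  obtain z where z: "\<And>n. z n \<in> range A" and lim: "(\<lambda>n. A_norm A (x - z n)) \<longlonglongrightarrow> 0"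
    using range_A_dense[of x] by blast
  have "(\<lambda>n. l * A_norm A (x - z n)) \<longlonglongrightarrow> 0"
    using tendsto_mult_right_zero[OF lim] .
  then have limT: "(\<lambda>n. A_norm A (T x - T (z n))) \<longlonglongrightarrow> 0"
    by (rule LIMSEQ_squeeze_zero[OF _ snorm_nonneg])
      (use l(2)[of "x - z n" for n] in \<open>simp add: clinear_diff[OF lin]\<close>)
  have conv: "(\<lambda>n. A_norm A (b n)) \<longlonglongrightarrow> A_norm A a" if "(\<lambda>n. A_norm A (a - b n)) \<longlonglongrightarrow> 0" for a b
  proof -
    have "(\<lambda>n. A_norm A (b n) - A_norm A a) \<longlonglongrightarrow> 0"
    proof (rule Lim_null_comparison[OF always_eventually that], rule allI)
      show "norm (A_norm A (b n) - A_norm A a) \<le> A_norm A (a - b n)" for n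
        using snorm_triangle_diff[of a "b n"] by (simp add: abs_minus_commute)
    qed
    then show ?thesis by (simp add: LIM_zero_iff)
  qed
  have "A_norm A (T (z n)) \<le> A_opnorm A T * A_norm A (z n)" for n
  proof (cases "A_norm A (z n) = 0")
    \<comment> \<open>The quotient carries no information here, but \<open>A\<close>-boundedness
      makes \<open>T (z n)\<close> null as well.\<close>
    case True
    then show ?thesis using l(2)[of "z n"] by simp
  next
    case False
    then have "z n \<noteq> 0" by auto
    moreover have "z n \<in> closure (range A)" using z[of n] range_closure by auto
    ultimately show ?thesis
      using opnorm_upper[OF T, of "z n"] False snorm_nonneg[of "z n"] by (simp add: field_simps)
  qed
  then show ?thesis
    using conv[OF limT] tendsto_mult_left[OF conv[OF lim]] by (auto intro: LIMSEQ_le)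
qed

end

text \<open>A nonzero \<open>A\<close> makes the index sets of both suprema nonempty.\<close>

locale nonzero_positive_op = positive_op +
  assumes nonzero: "A \<noteq> (\<lambda>x. 0)"
begin

lemma opnorm_nonneg:
  assumes T: "T \<in> A_bounded_operators A"
  shows "0 \<le> A_opnorm A T"
proof -
  obtain y where y: "A y \<noteq> 0" using nonzero by auto
  have "A y \<in> closure (range A)" by (rule range_closure)
  then have "A_norm A (T (A y)) / A_norm A (A y) \<le> A_opnorm A T"
    using opnorm_upper[OF T] y by blast
  moreover have "0 \<le> A_norm A (T (A y)) / A_norm A (A y)"
    by (simp add: snorm_nonneg)
  ultimately show ?thesis by linarith
qed

lemma opnorm_least:
  assumes "0 \<le> c" and c: "\<And>x. A_norm A (T x) \<le> c * A_norm A x"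
  shows "A_opnorm A T \<le> c"
  unfolding A_opnorm_def
proof (rule cSUP_least)
  obtain y where "A y \<noteq> 0" using nonzero by auto
  moreover have "A y \<in> closure (range A)" by (rule range_closure)
  ultimately show "{x \<in> closure (range A). x \<noteq> 0} \<noteq> {}" by blast
  show "A_norm A (T y) / A_norm A y \<le> c" for y
    using assms(1) c[of y] snorm_nonneg[of y] by (cases "A_norm A y = 0") (auto simp: field_simps)
qed

lemma opnorm_funpow_le:
  assumes T: "T \<in> A_bounded_operators A"
  shows "A_opnorm A (T ^^ n) \<le> A_opnorm A T ^ n"
  using opnorm_nonneg[OF T] opnorm_bound[OF T]
  by (intro opnorm_least snorm_funpow_le) auto

lemma exists_unit: "\<exists>x. A_norm A x = 1"
proof -
  obtain y where "A y \<noteq> 0" using nonzero by auto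
  \<comment> \<open>\<open>A_inner A y (A y)\<close> is the square of \<open>norm (A y)\<close>, so
    by Cauchy-Schwarz \<open>y\<close> is not null.\<close>
  then have "A_inner A y (A y) \<noteq> 0" by (simp add: A_inner_def cinner_self)
  then have "A_norm A y \<noteq> 0"
    using Cauchy_Schwarz[of y "A y"] by auto
  then have "A_norm A (scaleC (1 / A_norm A y) y) = 1"
    using snorm_nonneg[of y] by (simp add: snorm_scaleC norm_divide)
  then show ?thesis by blast
qed

section \<open>Numerical radius and spectral radius of a fixed operator\<close>

context
  fixes T
  assumes T: "T \<in> A_bounded_operators A"
begin

lemma numerical_radius_upper:
  assumes "A_norm A x = 1"
  shows "cmod (A_inner A (T x) x) \<le> A_numerical_radius A T"
proof -
  have "bdd_above ((\<lambda>x. cmod (A_inner A (T x) x)) ` {x. A_norm A x = 1})"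
  proof (rule bdd_aboveI2)
    show "cmod (A_inner A (T x) x) \<le> A_opnorm A T" if "x \<in> {x. A_norm A x = 1}" for x
      using numerical_le_norm[OF opnorm_bound[OF T], of x] that by simp
  qed
  then show ?thesis
    unfolding A_numerical_radius_def using assms by (intro cSUP_upper) auto
qed

lemma numerical_radius_nonneg: "0 \<le> A_numerical_radius A T"
  using exists_unit numerical_radius_upper norm_ge_zero order_trans by blast

lemma numerical_radius_bound: "cmod (A_inner A (T x) x) \<le> A_numerical_radius A T * (A_norm A x)\<^sup>2"
proof (cases "A_norm A x = 0")
  case True
  then show ?thesis using Cauchy_Schwarz[of "T x" x] by simp
next
  case False
  define r where "r = 1 / A_norm A x"
  have lin: "clinear T"
    using T by (auto simp: A_bounded_operators_def bounded_clinear_imp_clinear)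
  have r: "0 < r" "r * A_norm A x = 1"
    using False snorm_nonneg[of x] by (simp_all add: r_def)
  then have "A_norm A (scaleC r x) = 1"
    by (simp add: snorm_scaleC)
  then have "r\<^sup>2 * cmod (A_inner A (T x) x) \<le> A_numerical_radius A T"
    using numerical_radius_upper[of "scaleC r x"] r
    by (simp add: clinear_scaleC[OF lin] sesqui norm_mult power2_eq_square mult_ac)
  then show ?thesis
    using False by (simp add: r_def field_simps)
qed

lemma numerical_radius_le_opnorm: "A_numerical_radius A T \<le> A_opnorm A T"
  unfolding A_numerical_radius_def
proof (rule cSUP_least)
  show "cmod (A_inner A (T x) x) \<le> A_opnorm A T" if "x \<in> {x. A_norm A x = 1}" for x
    using numerical_le_norm[OF opnorm_bound[OF T], of x] that by simp
qed (use exists_unit in auto)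

lemma numerical_radius_sequence:
  obtains x where "\<And>n::nat. A_norm A (x n) = 1"
    "(\<lambda>n. cmod (A_inner A (T (x n)) (x n))) \<longlonglongrightarrow> A_numerical_radius A T"
proof -
  define w where "w = A_numerical_radius A T"
  have "\<exists>x. A_norm A x = 1 \<and> w - inverse (real (Suc n)) < cmod (A_inner A (T x) x)" for n
  proof (rule ccontr)
    assume "\<not> ?thesis"
    then have "A_numerical_radius A T \<le> w - inverse (real (Suc n))"
      unfolding A_numerical_radius_def using exists_unit
      by (intro cSUP_least) (auto simp: not_less)
    then show False
      by (simp flip: w_def)
  qed
  then obtain x where x: "\<And>n. A_norm A (x n) = 1"
      "\<And>n. w - inverse (real (Suc n)) < cmod (A_inner A (T (x n)) (x n))"
    by metis
  have "(\<lambda>n. w - inverse (real (Suc n))) \<longlonglongrightarrow> w - 0"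
    by (intro tendsto_intros LIMSEQ_inverse_real_of_nat)
  then have "(\<lambda>n. cmod (A_inner A (T (x n)) (x n))) \<longlonglongrightarrow> w"
    unfolding diff_0_right
    by (rule LIMSEQ_squeeze_below)
      (use numerical_radius_upper[OF x(1)] x(2) in \<open>auto simp: w_def intro: less_imp_le\<close>)
  then show thesis
    unfolding w_def by (rule that[OF x(1)])
qed

text \<open>If the infimum is \<open>A_opnorm A T\<close>, then no \<open>n\<close>-th root lies
  below that value; \<open>opnorm_funpow_le\<close> gives the other bound. Conversely, all the roots
  coincide.\<close>

lemma spectral_radius_eq_iff:
  "A_spectral_radius A T = A_opnorm A T
    \<longleftrightarrow> (\<forall>n\<ge>1. A_opnorm A (T ^^ n) = A_opnorm A T ^ n)" (is "?L \<longleftrightarrow> ?R")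
proof
  define M where "M = A_opnorm A T"
  have "0 \<le> M" by (simp add: M_def opnorm_nonneg[OF T])
  {
    assume ?L
    show ?R
    proof (intro allI impI antisym)
      fix n :: nat
      assume n: "1 \<le> n"
      have nn: "0 \<le> A_opnorm A (T ^^ k)" for k
        using T by (intro opnorm_nonneg A_bounded_funpow)
      have "bdd_below ((\<lambda>n. root n (A_opnorm A (T ^^ n))) ` {1::nat..})"
        by (intro bdd_belowI[of _ 0]) (auto simp: nn)
      then have "M \<le> root n (A_opnorm A (T ^^ n))"
        using \<open>?L\<close> n unfolding A_spectral_radius_def M_def[symmetric]
        by (metis atLeast_iff cINF_lower)
      then have "M ^ n \<le> root n (A_opnorm A (T ^^ n)) ^ n"
        using \<open>0 \<le> M\<close> by (intro power_mono)
      then show "A_opnorm A T ^ n \<le> A_opnorm A (T ^^ n)"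
        using n nn by (simp add: M_def)
    qed (rule opnorm_funpow_le[OF T])
  next
    assume ?R
    then have "(\<lambda>n. root n (A_opnorm A (T ^^ n))) ` {1::nat..} = {M}"
      using \<open>0 \<le> M\<close> by (force simp: M_def real_root_power_cancel image_iff)
    then show ?L
      by (simp add: A_spectral_radius_def M_def)
  }
qed

end

end

theorem proposition2p4:
  fixes A T :: "'a::complex_hilbert_space \<Rightarrow> 'a"
  assumes "\<exists>x::'a. x \<noteq> 0"
    and "positive_operator A"
    and "A \<noteq> (\<lambda>x. 0)"
    and "T \<in> A_bounded_operators A"
  shows "(A_normaloid A T
            \<longleftrightarrow> (\<forall>n::nat\<ge>1. A_opnorm A (T ^^ n) = A_opnorm A T ^ n)) \<and>
         ((\<forall>n::nat\<ge>1. A_opnorm A (T ^^ n) = A_opnorm A T ^ n)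
            \<longleftrightarrow> A_numerical_radius A T = A_opnorm A T) \<and>
         (A_numerical_radius A T = A_opnorm A T
            \<longleftrightarrow> (\<exists>x :: nat \<Rightarrow> 'a. (\<forall>n. A_norm A (x n) = 1) \<and>
                   (\<lambda>n. A_norm A (T (x n))) \<longlonglongrightarrow> A_opnorm A T \<and>
                   (\<lambda>n. cmod (A_inner A (T (x n)) (x n))) \<longlonglongrightarrow> A_numerical_radius A T))"
proof -
  interpret nonzero_positive_op A
    by unfold_locales (use assms in auto)
  note T = assms(4)
  define M w where "M = A_opnorm A T" and "w = A_numerical_radius A T"
  have lin: "clinear T"
    using T by (auto simp: A_bounded_operators_def bounded_clinear_imp_clinear)
  have M: "0 \<le> M" "\<And>x. A_norm A (T x) \<le> M * A_norm A x"
    using opnorm_nonneg[OF T] opnorm_bound[OF T] by (auto simp: M_def)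
  have w: "0 \<le> w" "w \<le> M" "\<And>x. cmod (A_inner A (T x) x) \<le> w * (A_norm A x)\<^sup>2"
    using numerical_radius_nonneg[OF T] numerical_radius_le_opnorm[OF T] numerical_radius_bound[OF T]
    by (auto simp: M_def w_def)
  \<comment> \<open>This sequence serves twice: when \<open>w = M\<close> it gives approximate
    eigenvectors for (2) and is also the sequence required by (4).\<close>
  obtain x where unit: "\<And>n. A_norm A (x n) = 1"
    and lim: "(\<lambda>n. cmod (A_inner A (T (x n)) (x n))) \<longlonglongrightarrow> w"
    using numerical_radius_sequence[OF T] unfolding w_def by blast
  have "A_normaloid A T \<longleftrightarrow> (\<forall>n\<ge>1. A_opnorm A (T ^^ n) = M ^ n)"
    using spectral_radius_eq_iff[OF T] T by (simp add: A_normaloid_def M_def)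
  moreover have "(\<forall>n\<ge>1. A_opnorm A (T ^^ n) = M ^ n) \<longleftrightarrow> w = M"
  proof
    assume pow: "\<forall>n\<ge>1. A_opnorm A (T ^^ n) = M ^ n"
    have "M \<le> w"
    proof (rule norm_le_numerical_radius[OF lin w(3,1)])
      fix n c
      assume c: "0 \<le> (c::real)" "\<And>x. A_norm A ((T ^^ n) x) \<le> c * A_norm A x"
      show "M ^ n \<le> c"
      proof (cases "n = 0")
        \<comment> \<open>\<open>T ^^ 0\<close> is the identity, so any unit vector forces
          \<open>c \<ge> 1\<close>.\<close>
        case True
        then show ?thesis using c(2)[of "x 0"] unit by simp
      next
        case False
        then show ?thesis using opnorm_least[OF c] pow by simp
      qed
    qed
    then show "w = M" using w(2) by simp
  next
    assume "w = M"
    show "\<forall>n\<ge>1. A_opnorm A (T ^^ n) = M ^ n"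
    proof (intro allI impI antisym)
      fix n :: nat
      show "A_opnorm A (T ^^ n) \<le> M ^ n"
        unfolding M_def by (rule opnorm_funpow_le[OF T])
      show "M ^ n \<le> A_opnorm A (T ^^ n)"
        using norm_power_le_of_numerical[OF lin M unit lim[unfolded \<open>w = M\<close>]]
          opnorm_bound[OF A_bounded_funpow[OF T]] by blast
    qed
  qed
  moreover have "w = M \<longleftrightarrow> (\<exists>x :: nat \<Rightarrow> 'a. (\<forall>n. A_norm A (x n) = 1) \<and>
      (\<lambda>n. A_norm A (T (x n))) \<longlonglongrightarrow> M \<and> (\<lambda>n. cmod (A_inner A (T (x n)) (x n))) \<longlonglongrightarrow> w)" (is "_ \<longleftrightarrow> ?R")
  proof
    assume "w = M"
    \<comment> \<open>Once \<open>w = M\<close>, the norms are squeezed between the numerical values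
      and \<open>M\<close>.\<close>
    have "cmod (A_inner A (T (x n)) (x n)) \<le> A_norm A (T (x n))" "A_norm A (T (x n)) \<le> M" for n
      using Cauchy_Schwarz[of "T (x n)" "x n"] M(2)[of "x n"] unit by simp_all
    then have "(\<lambda>n. A_norm A (T (x n))) \<longlonglongrightarrow> M"
      by (rule LIMSEQ_squeeze_below[OF lim[unfolded \<open>w = M\<close>]])
    then show ?R
      using unit lim by blast
  next
    assume ?R
    then show "w = M"
      using numerical_eq_norm_of_common_sequence[OF lin M(2) w] by blast
  qed
  ultimately show ?thesis
    by (simp only: M_def w_def)
qed

end
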